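(* Let $\mathbf k$ be a field of characteristic $0$, $\lambda\in\mathbf k$, and let $(\mathfrak g,\mu,d)$ be a differential Lie algebra of weight $\lambda$ over $\mathbf k$. Let $sM\oplus A$ be the $L_\infty[1]$-algebra of the vector space $\mathfrak g$ with parameter $\lambda$ described in the context, in which $(s\mu,d)$ is a Maurer-Cartan element, and twist it by $(s\mu,d)$. Then the underlying complex $(sM\oplus A,\,l_1^{(s\mu,d)})$ of the twisted $L_\infty[1]$-algebra is exactly the double shift of the cochain complex $\mathrm C^*_{\mathrm{DL}_\lambda}(\mathfrak g,\mathfrak g_{\mathrm{ad}})$ of the differential Lie algebra $(\mathfrak g,\mu,d)$ with coefficients in its adjoint representation, up to signs (where, for $n\ge1$, $\mathrm C^n_{\mathrm{DL}_\lambda}(\mathfrak g,\mathfrak g_{\mathrm{ad}})=\mathrm{Hom}(\wedge^n\mathfrak g,\mathfrak g)\oplus\mathrm{Hom}(\wedge^{n-1}\mathfrak g,\mathfrak g)$ is identified with the degree $n-2$ part of $sM\oplus A$).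
   Context: A differential Lie algebra of weight $\lambda$ is a Lie algebra $(\mathfrak g,\mu=[\,,])$ with a linear map $d:\mathfrak g\to\mathfrak g$ such that $d([x,y])=[d(x),y]+[x,d(y)]+\lambda[d(x),d(y)]$. Complex. Let $\rho(x)=[x,-]$ (adjoint representation, with operator $d$ on $\mathfrak g$) and $\rho_\lambda(x)=\rho(x+\lambda d(x))$. For $n\ge0$ and $f\in\mathrm{Hom}(\wedge^n\mathfrak g,\mathfrak g)$, $$\partial^n_{\mathrm{Lie}}(f)(x_1,\dots,x_{n+1})=\sum_{i}(-1)^{i+n}\rho(x_i)f(x_1,\dots,\hat x_i,\dots,x_{n+1})+\sum_{i<j}(-1)^{i+j+n+1}f([x_i,x_j],x_1,\dots,\hat x_i,\dots,\hat x_j,\dots,x_{n+1}),$$ $\partial^n_{\mathrm{DO}_\lambda}$ is the same with $\rho_\lambda$ in place of $\rho$; $\delta^0v=-d(v)$ and for $n\ge1$ $$\delta^nf(x_1,\dots,x_n)=\sum_{k=1}^n\lambda^{k-1}\sum_{i_1<\dots<i_k}f(x_1,\dots,d(x_{i_1}),\dots,d(x_{i_k}),\dots,x_n)-d(f(x_1,\dots,x_n)).$$ $\mathrm C^*_{\mathrm{DL}_\lambda}(\mathfrak g,\mathfrak g_{\mathrm{ad}})$ is the negative shift of the mapping cone of $\delta^*$: it is $\mathfrak g$ in degree $0$ and $\mathrm{Hom}(\wedge^n\mathfrak g,\mathfrak g)\oplus\mathrm{Hom}(\wedge^{n-1}\mathfrak g,\mathfrak g)$ in degree $n\ge1$, with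 $\partial^0_{\mathrm{DL}_\lambda}v=(\partial^0_{\mathrm{Lie}}v,-\delta^0v)$ and $\partial^n_{\mathrm{DL}_\lambda}(f,g)=(\partial^n_{\mathrm{Lie}}f,-\partial^{n-1}_{\mathrm{DO}_\lambda}g-\delta^nf)$ for $n\ge1$. $L_\infty[1]$-algebra. $\bar\wedge\mathfrak g=\bigoplus_{k\ge1}\wedge^k\mathfrak g$; $M=A=\mathrm{Hom}(\bar\wedge\mathfrak g,\mathfrak g)$ with $\mathrm{Hom}(\wedge^{n+1}\mathfrak g,\mathfrak g)$ in degree $n$; $(sM)^n=M^{n+1}$. $[f,g]_{\mathrm{NR}}=f\bar\circ g-(-1)^{pq}g\bar\circ f$ for $f,g$ of degrees $p,q$, where $f\bar\circ g(x_1,\dots,x_{p+q+1})=\sum_{\sigma\in\mathrm{Sh}(q+1,p)}\mathrm{sgn}(\sigma)f(g(x_{\sigma(1)},\dots,x_{\sigma(q+1)}),x_{\sigma(q+2)},\dots,x_{\sigma(p+q+1)})$, and $\mathrm{Sh}(i_1,\dots,i_r)$ denotes the set of $(i_1,\dots,i_r)$-shuffles. The operations on $sM\oplus A$ are $l_2(sf,sg)=(-1)^{|f|}s[f,g]_{\mathrm{NR}}$, $l_2(sf,\xi)=[f,\xi]_{\mathrm{NR}}$, and for $3\le i\le n+2$ $$l_i(sf,\xi_1,\dots,\xi_{i-1})=\sum_{\tau\in\mathrm{Sh}(m_{i-1}+1,\dots,m_1+1,n+2-i)}(-1)^{\sum_{j=1}^{i-1}(m_1+\cdots+m_{j-1})m_j}\lambda^{i-2}f(\xi_{i-1}\otimes\cdots\otimes\xi_1\otimes\mathrm{Id}^{\otimes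 n+2-i})\tau^{-1}$$ for $f\in\mathrm{Hom}(\wedge^{n+1}\mathfrak g,\mathfrak g)\subseteq M$, $\xi_j\in\mathrm{Hom}(\wedge^{m_j+1}\mathfrak g,\mathfrak g)\subseteq A$, extended by graded symmetry, all other components zero. Here $\tau^{-1}(x_1,\dots,x_t)=\mathrm{sgn}(\tau)(x_{\tau(1)},\dots,x_{\tau(t)})$, and with $r=i-1$ the tensor product of maps applied to consecutive blocks $a_r,\dots,a_1,b$ of arguments is $(-1)^{\sum_{k<j}m_k(m_j+1)}(\xi_r(a_r),\dots,\xi_1(a_1),b)$ (Koszul rule with elements of $\mathfrak g$ odd). A Maurer-Cartan element is a degree $0$ element $\alpha$ with $\sum_{n\ge1}\frac1{n!}l_n(\alpha^{\otimes n})=0$. The differential of the $L_\infty[1]$-algebra twisted by $\alpha$ is $l_1^\alpha(x)=\sum_{k\ge0}\frac1{k!}l_{k+1}(\alpha^{\otimes k}\otimes x)$.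
   Formalization: For n=1 the degree -1 part of sM⊕A is only Hom(g,g), as A has no arity-0 part, so it is identified with the summand Hom(g,g)⊕0 of C^1, not all of C^1; the differentials are still shown to agree up to sign on all of C^1, with the same formulas for l_i applied to the extra summand g. *)

theory Defs
  imports
    Complex_Main
    "HOL-Combinatorics.Permutations"
    "HOL-Library.Groups_Big_Fun"
    "HOL-Library.Function_Algebras"
    "HOL-Library.Product_Plus"
begin

section \<open>Differential Lie algebras of weight \<open>\<lambda>\<close>\<close>

locale lie_algebra = vector_space scale
  for scale :: "'k::field \<Rightarrow> 'g::ab_group_add \<Rightarrow> 'g" +
  fixes br :: "'g \<Rightarrow> 'g \<Rightarrow> 'g"
  assumes linear_left: "Vector_Spaces.linear scale scale (\<lambda>x. br x y)"
    and linear_right: "Vector_Spaces.linear scale scale (br x)"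
    and br_self: "br x x = 0"
    and jacobi: "br x (br y z) + br y (br z x) + br z (br x y) = 0"

locale differential_lie_algebra = lie_algebra scale br
  for scale :: "'k::field \<Rightarrow> 'g::ab_group_add \<Rightarrow> 'g" and br :: "'g \<Rightarrow> 'g \<Rightarrow> 'g" +
  fixes lam :: 'k and d :: "'g \<Rightarrow> 'g"
  assumes linear_d: "Vector_Spaces.linear scale scale d"
    and d_br: "d (br x y) = br (d x) y + br x (d y) + scale lam (br (d x) (d y))"

section \<open>Cochains\<close>

text \<open>A map of \<open>n\<close> arguments is a function on lists that is \<open>0\<close> on all lists whose length is
  not \<open>n\<close>. The space \<open>Hom(\<And>\<^sup>n g, g)\<close> is rendered, for every \<open>n \<ge> 0\<close>, as the alternating
  \<open>n\<close>-linear maps; for \<open>n = 0\<close> these are the elements of \<open>g\<close>, namely the values on the empty list.\<close>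

type_synonym 'g cochain = "'g list \<Rightarrow> 'g"

definition Hom_alt :: "('k::field \<Rightarrow> 'g::ab_group_add \<Rightarrow> 'g) \<Rightarrow> nat \<Rightarrow> 'g cochain set" where
  "Hom_alt scale n = {f.
     (\<forall>xs. length xs \<noteq> n \<longrightarrow> f xs = 0) \<and>
     (\<forall>xs i. length xs = n \<longrightarrow> i < n \<longrightarrow> Vector_Spaces.linear scale scale (\<lambda>x. f (xs[i := x]))) \<and>
     (\<forall>xs i j. length xs = n \<longrightarrow> i < j \<longrightarrow> j < n \<longrightarrow> xs ! i = xs ! j \<longrightarrow> f xs = 0)}"

definition cochain1 :: "('g \<Rightarrow> 'g) \<Rightarrow> 'g::ab_group_add cochain" where
  "cochain1 d xs = (if length xs = 1 then d (xs ! 0) else 0)"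

definition cochain2 :: "('g \<Rightarrow> 'g \<Rightarrow> 'g) \<Rightarrow> 'g::ab_group_add cochain" where
  "cochain2 br xs = (if length xs = 2 then br (xs ! 0) (xs ! 1) else 0)"

definition smul :: "('k \<Rightarrow> 'g \<Rightarrow> 'g) \<Rightarrow> 'k \<Rightarrow> 'g cochain \<times> 'g cochain \<Rightarrow> 'g cochain \<times> 'g cochain" where
  "smul scale c x = (\<lambda>xs. scale c (fst x xs), \<lambda>xs. scale c (snd x xs))"

section \<open>The cochain complex of a differential Lie algebra with adjoint coefficients\<close>

text \<open>The Chevalley-Eilenberg formula for an operator \<open>\<rho>\<close>. The argument \<open>x\<^sub>i\<close> of the usual
  1-based notation is \<open>xs ! (i - 1)\<close>, hence the successors in the exponents.\<close>

definition dCE :: "('k::field \<Rightarrow> 'g::ab_group_add \<Rightarrow> 'g) \<Rightarrow> ('g \<Rightarrow> 'g \<Rightarrow> 'g) \<Rightarrow> ('g \<Rightarrow> 'g \<Rightarrow> 'g)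
    \<Rightarrow> nat \<Rightarrow> 'g cochain \<Rightarrow> 'g cochain" where
  "dCE scale br \<rho> n f xs = (if length xs = n + 1 then
     (\<Sum>i<n + 1. scale ((- 1) ^ (Suc i + n)) (\<rho> (xs ! i) (f (nths xs (- {i}))))) +
     (\<Sum>j<n + 1. \<Sum>i<j. scale ((- 1) ^ (Suc i + Suc j + n + 1))
        (f (br (xs ! i) (xs ! j) # nths xs (- {i, j}))))
   else 0)"

definition d_Lie :: "('k::field \<Rightarrow> 'g::ab_group_add \<Rightarrow> 'g) \<Rightarrow> ('g \<Rightarrow> 'g \<Rightarrow> 'g)
    \<Rightarrow> nat \<Rightarrow> 'g cochain \<Rightarrow> 'g cochain" where
  "d_Lie scale br = dCE scale br br"

definition d_DO :: "('k::field \<Rightarrow> 'g::ab_group_add \<Rightarrow> 'g) \<Rightarrow> ('g \<Rightarrow> 'g \<Rightarrow> 'g) \<Rightarrow> 'k \<Rightarrow> ('g \<Rightarrow> 'g)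
    \<Rightarrow> nat \<Rightarrow> 'g cochain \<Rightarrow> 'g cochain" where
  "d_DO scale br lam d = dCE scale br (\<lambda>x. br (x + scale lam (d x)))"

text \<open>The inner sum runs over the sets \<open>I = {i\<^sub>1 < \<dots> < i\<^sub>k}\<close> of positions; for \<open>n = 0\<close> the
  formula gives \<open>- d v\<close>.\<close>

definition delta :: "('k::field \<Rightarrow> 'g::ab_group_add \<Rightarrow> 'g) \<Rightarrow> 'k \<Rightarrow> ('g \<Rightarrow> 'g)
    \<Rightarrow> nat \<Rightarrow> 'g cochain \<Rightarrow> 'g cochain" where
  "delta scale lam d n f xs = (if length xs = n then
     (\<Sum>k = 1..n. scale (lam ^ (k - 1))
        (\<Sum>I | I \<subseteq> {..<n} \<and> card I = k.
           f (map (\<lambda>i. if i \<in> I then d (xs ! i) else xs ! i) [0..<n])))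
     - d (f xs)
   else 0)"

definition C_DL :: "('k::field \<Rightarrow> 'g::ab_group_add \<Rightarrow> 'g) \<Rightarrow> nat \<Rightarrow> ('g cochain \<times> 'g cochain) set" where
  "C_DL scale n = (if n = 0 then Hom_alt scale 0 \<times> {0} else Hom_alt scale n \<times> Hom_alt scale (n - 1))"

definition d_DL :: "('k::field \<Rightarrow> 'g::ab_group_add \<Rightarrow> 'g) \<Rightarrow> ('g \<Rightarrow> 'g \<Rightarrow> 'g) \<Rightarrow> 'k \<Rightarrow> ('g \<Rightarrow> 'g)
    \<Rightarrow> nat \<Rightarrow> 'g cochain \<times> 'g cochain \<Rightarrow> 'g cochain \<times> 'g cochain" where
  "d_DL scale br lam d n x = (case x of (f, g) \<Rightarrow>
     (d_Lie scale br n f,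
      if n = 0 then - delta scale lam d 0 f
      else - d_DO scale br lam d (n - 1) g - delta scale lam d n f))"

section \<open>The \<open>L\<^sub>\<infinity>[1]\<close>-algebra \<open>sM \<oplus> A\<close>\<close>

text \<open>Shuffles with respect to consecutive blocks of sizes \<open>bs\<close>, on 0-based positions.\<close>

definition Shuffles :: "nat list \<Rightarrow> (nat \<Rightarrow> nat) set" where
  "Shuffles bs = {\<sigma>. \<sigma> permutes {..<sum_list bs} \<and>
     (\<forall>j<length bs. strict_mono_on {sum_list (take j bs)..<sum_list (take (Suc j) bs)} \<sigma>)}"

text \<open>The product \<open>f \<circ> g\<close> and the Nijenhuis-Richardson bracket for \<open>f\<close> and \<open>g\<close> of arities \<open>a\<close>
  and \<open>b\<close>, that is, of degrees \<open>a - 1\<close> and \<open>b - 1\<close>. The product vanishes if \<open>a = 0\<close>.\<close>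

definition nr_comp :: "('k::field \<Rightarrow> 'g::ab_group_add \<Rightarrow> 'g)
    \<Rightarrow> nat \<Rightarrow> nat \<Rightarrow> 'g cochain \<Rightarrow> 'g cochain \<Rightarrow> 'g cochain" where
  "nr_comp scale a b f g xs = (if 1 \<le> a \<and> length xs + 1 = a + b then
     (\<Sum>\<sigma>\<in>Shuffles [b, a - 1]. let ys = permute_list \<sigma> xs in
        scale (of_int (sign \<sigma>)) (f (g (take b ys) # drop b ys)))
   else 0)"

definition nr_bracket :: "('k::field \<Rightarrow> 'g::ab_group_add \<Rightarrow> 'g)
    \<Rightarrow> nat \<Rightarrow> nat \<Rightarrow> 'g cochain \<Rightarrow> 'g cochain \<Rightarrow> 'g cochain" where
  "nr_bracket scale a b f g xs = nr_comp scale a b f g xs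
     - scale ((- 1) powi ((int a - 1) * (int b - 1))) (nr_comp scale b a g f xs)"

text \<open>Maps of given arities applied to consecutive blocks, and the identity applied to the
  remaining arguments; the Koszul sign is kept separately.\<close>

fun apply_blocks :: "(nat \<times> 'g cochain) list \<Rightarrow> 'g list \<Rightarrow> 'g list" where
  "apply_blocks [] xs = xs"
| "apply_blocks ((b, \<xi>) # \<xi>s) xs = \<xi> (take b xs) # apply_blocks \<xi>s (drop b xs)"

text \<open>The exponents of -1 in the defining formula of \<open>l\<^sub>i\<close> and in the Koszul sign of the tensor product of
  maps, for the list of degrees \<open>[m\<^sub>1, \<dots>, m\<^sub>r]\<close>.\<close>

definition l_exponent :: "int list \<Rightarrow> int" where
  "l_exponent ms = (\<Sum>j<length ms. (\<Sum>k<j. ms ! k) * ms ! j)"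

definition koszul_exponent :: "int list \<Rightarrow> int" where
  "koszul_exponent ms = (\<Sum>j<length ms. \<Sum>k<j. ms ! k * (ms ! j + 1))"

text \<open>The component \<open>l\<^sub>i(sf, \<xi>\<^sub>1, \<dots>, \<xi>\<^sub>i\<^sub>-\<^sub>1)\<close> with \<open>i \<ge> 3\<close>, for \<open>f\<close> of arity \<open>a\<close> and the list of
  the \<open>\<xi>\<^sub>j\<close> paired with their arities \<open>m\<^sub>j + 1\<close>. With \<open>r = i - 1\<close> and \<open>a = n + 1\<close>, the
  condition \<open>3 \<le> i \<le> n + 2\<close> becomes \<open>2 \<le> r \<le> a\<close>.\<close>

definition l_higher :: "('k::field \<Rightarrow> 'g::ab_group_add \<Rightarrow> 'g) \<Rightarrow> 'k
    \<Rightarrow> nat \<Rightarrow> 'g cochain \<Rightarrow> (nat \<times> 'g cochain) list \<Rightarrow> 'g cochain" where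
  "l_higher scale lam a f \<xi>s xs =
    (let r = length \<xi>s; ms = map (\<lambda>(b, \<xi>). int b - 1) \<xi>s in
     if 2 \<le> r \<and> r \<le> a \<and> length xs = sum_list (map fst \<xi>s) + (a - r) then
       (\<Sum>\<tau>\<in>Shuffles (rev (map fst \<xi>s) @ [a - r]).
          scale ((- 1) powi l_exponent ms * lam ^ (r - 1) * (- 1) powi koszul_exponent ms * of_int (sign \<tau>))
            (f (apply_blocks (rev \<xi>s) (permute_list \<tau> xs))))
     else 0)"

definition l_mixed :: "('k::field \<Rightarrow> 'g::ab_group_add \<Rightarrow> 'g) \<Rightarrow> 'k
    \<Rightarrow> nat \<Rightarrow> 'g cochain \<Rightarrow> (nat \<times> 'g cochain) list \<Rightarrow> 'g cochain" where
  "l_mixed scale lam a f \<xi>s =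
    (case \<xi>s of [(b, \<xi>)] \<Rightarrow> nr_bracket scale a b f \<xi> | _ \<Rightarrow> l_higher scale lam a f \<xi>s)"

text \<open>An element of degree \<open>e\<close> of \<open>sM \<oplus> A\<close> is a pair \<open>(sf, \<xi>)\<close> in which \<open>f\<close> has degree
  \<open>e + 1\<close> in \<open>M\<close>, so arity \<open>e + 2\<close>, and \<open>\<xi>\<close> has arity \<open>e + 1\<close>. As \<open>M = A = Hom(\<And>\<^sup>k g, g)\<close> with
  \<open>k \<ge> 1\<close>, both vanish in negative degrees.\<close>

definition M_deg :: "('k::field \<Rightarrow> 'g::ab_group_add \<Rightarrow> 'g) \<Rightarrow> int \<Rightarrow> 'g cochain set" where
  "M_deg scale e = (if e \<ge> 0 then Hom_alt scale (nat (e + 1)) else {0})"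

definition sMA_deg :: "('k::field \<Rightarrow> 'g::ab_group_add \<Rightarrow> 'g) \<Rightarrow> int
    \<Rightarrow> ('g cochain \<times> 'g cochain) set" where
  "sMA_deg scale e = M_deg scale (e + 1) \<times> M_deg scale e"

text \<open>The operation \<open>l\<^sub>i\<close> on a list of \<open>i\<close> homogeneous elements, each given with its degree. The
  first component is \<open>l\<^sub>2(sf, sg)\<close>. The second one sums over the position \<open>p\<close> of the argument
  taken from \<open>sM\<close>, all others being taken from \<open>A\<close>; moving that argument to the front gives the
  sign of graded symmetry. In particular \<open>l\<^sub>1 = 0\<close>. The formulas make sense without change for
  components of arity \<open>0\<close>.\<close>

definition l_op :: "('k::field \<Rightarrow> 'g::ab_group_add \<Rightarrow> 'g) \<Rightarrow> 'k
    \<Rightarrow> (int \<times> 'g cochain \<times> 'g cochain) list \<Rightarrow> 'g cochain \<times> 'g cochain" where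
  "l_op scale lam es =
    ((case es of [(e\<^sub>1, f, _), (e\<^sub>2, g, _)] \<Rightarrow>
        (\<lambda>xs. scale ((- 1) powi (e\<^sub>1 + 1)) (nr_bracket scale (nat (e\<^sub>1 + 2)) (nat (e\<^sub>2 + 2)) f g xs))
      | _ \<Rightarrow> 0),
     (\<lambda>xs. \<Sum>p<length es. case es ! p of (e, f, _) \<Rightarrow>
        scale ((- 1) powi (e * (\<Sum>q<p. fst (es ! q))))
          (l_mixed scale lam (nat (e + 2)) f
             (map (\<lambda>(e', _, \<xi>). (nat (e' + 1), \<xi>)) (take p es @ drop (Suc p) es)) xs)))"

text \<open>The infinite sums below have finite support, since \<open>l\<^sub>i(sf, \<dots>) = 0\<close> as soon as \<open>i > 2\<close>
  and \<open>i - 1\<close> exceeds the arity of \<open>f\<close>.\<close>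

definition maurer_cartan :: "('k::field_char_0 \<Rightarrow> 'g::ab_group_add \<Rightarrow> 'g) \<Rightarrow> 'k
    \<Rightarrow> 'g cochain \<times> 'g cochain \<Rightarrow> bool" where
  "maurer_cartan scale lam \<alpha> \<longleftrightarrow> \<alpha> \<in> sMA_deg scale 0 \<and>
     (\<Sum>k. smul scale (1 / fact (Suc k)) (l_op scale lam (replicate (Suc k) (0, \<alpha>)))) = 0"

text \<open>The twisted differential \<open>l\<^sub>1\<^sup>\<alpha>\<close> on elements of degree \<open>e\<close>, for \<open>\<alpha>\<close> of degree \<open>0\<close>.\<close>

definition l1_twisted :: "('k::field_char_0 \<Rightarrow> 'g::ab_group_add \<Rightarrow> 'g) \<Rightarrow> 'k
    \<Rightarrow> 'g cochain \<times> 'g cochain \<Rightarrow> int \<Rightarrow> 'g cochain \<times> 'g cochain \<Rightarrow> 'g cochain \<times> 'g cochain" where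
  "l1_twisted scale lam \<alpha> e x =
     (\<Sum>k. smul scale (1 / fact k) (l_op scale lam (replicate k (0, \<alpha>) @ [(e, x)])))"

end

theory Submission
  imports Defs
begin

text \<open>Twisting by \<open>(s\<mu>, d)\<close> leaves, on \<open>(sf, g)\<close>, the terms with a single \<open>\<mu>\<close> and those in which
  all other arguments of \<open>f\<close> are copies of \<open>d\<close>. As \<open>\<mu>\<close> has two arguments, the former are two: \<open>[\<mu>, g]\<close> is the
  Chevalley-Eilenberg differential for \<open>\<rho>\<close>, and \<open>l\<^sub>3(s\<mu>, d, g)\<close> is the correction turning \<open>\<rho>\<close> into
  \<open>\<rho>\<^sub>\<lambda>\<close>. In \<open>l\<^sub>k\<^sub>+\<^sub>1(sf, d, \<dots>, d)\<close> the shuffles that send the copies of \<open>d\<close> to a given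
  set of \<open>k\<close> positions all contribute equally as \<open>f\<close> is alternating; there are \<open>k!\<close> of them, which
  cancels the factor \<open>1 / k!\<close> and leaves \<open>\<delta>\<close>. All signs \<open>\<epsilon>\<close> come out as \<open>-1\<close>. The Maurer-Cartan
  equation reduces in the same way to the Jacobi identity and to \<open>\<delta>\<mu> = 0\<close>, the weighted Leibniz rule.\<close>

section \<open>Shuffles\<close>

lemma strict_mono_on_eq_if_image_eq:
  fixes \<sigma> \<tau> :: "nat \<Rightarrow> nat"
  assumes "finite S" "strict_mono_on S \<sigma>" "strict_mono_on S \<tau>" "\<sigma> ` S = \<tau> ` S" "i \<in> S"
  shows "\<sigma> i = \<tau> i"
proof -
  let ?L = "sorted_list_of_set S"
  have sorted: "sorted_wrt (<) (map f ?L)" if "strict_mono_on S f" for f :: "nat \<Rightarrow> nat"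
    unfolding sorted_wrt_map
    by (rule sorted_wrt_mono_rel[OF _ strict_sorted_list_of_set[of S]])
      (use that assms(1) in \<open>auto simp: strict_mono_on_def\<close>)
  have "map \<sigma> ?L = map \<tau> ?L"
    by (rule strict_sorted_equal[OF sorted sorted]) (use assms in auto)
  then show ?thesis using assms(1,5) by auto
qed

lemma permutes_image_Compl:
  assumes "\<sigma> permutes A" "S \<subseteq> A"
  shows "\<sigma> ` S = A - \<sigma> ` (A - S)"
proof -
  have "\<sigma> ` (A - S) = A - \<sigma> ` S"
    using assms by (metis image_set_diff permutes_image permutes_inj)
  moreover have "\<sigma> ` S \<subseteq> A" using assms by (metis image_mono permutes_image)
  ultimately show ?thesis by auto
qed

text \<open>The values off \<open>S\<close> fix the image of \<open>S\<close> as a complement, and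
  an increasing map is determined by its image. This recovers a shuffle from its values outside one
  increasing block.\<close>

lemma permutes_eq_if_strict_mono_on:
  fixes \<sigma> \<tau> :: "nat \<Rightarrow> nat"
  assumes "finite A" "\<sigma> permutes A" "\<tau> permutes A" "strict_mono_on S \<sigma>" "strict_mono_on S \<tau>"
    and "S \<subseteq> A" "\<And>i. i \<in> A - S \<Longrightarrow> \<sigma> i = \<tau> i"
  shows "\<sigma> = \<tau>"
proof
  fix i
  have "\<sigma> ` (A - S) = \<tau> ` (A - S)" using assms(7) by (intro image_cong) auto
  then have "\<sigma> ` S = \<tau> ` S"
    using permutes_image_Compl[OF assms(2,6)] permutes_image_Compl[OF assms(3,6)] by simp
  then have "\<sigma> i = \<tau> i" if "i \<in> S"
    using strict_mono_on_eq_if_image_eq[OF _ assms(4,5) _ that] assms(1,6) finite_subset by blast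
  moreover have "\<sigma> i = \<tau> i" if "i \<notin> A"
    using that assms(2,3) by (simp add: permutes_not_in)
  ultimately show "\<sigma> i = \<tau> i" using assms(7) by blast
qed

lemma nths_upt_eq_filter: "nths [0..<n] A = filter (\<lambda>i. i \<in> A) [0..<n]"
  by (induction n) (simp_all add: nths_append nths_Cons)

lemma nths_conv_filter_upt: "nths xs A = map ((!) xs) (filter (\<lambda>i. i \<in> A) [0..<length xs])"
proof -
  have "nths xs A = nths (map ((!) xs) [0..<length xs]) A" by (simp add: map_nth)
  then show ?thesis by (simp only: nths_map nths_upt_eq_filter)
qed

text \<open>An increasing map lists its image in the order in which \<open>nths\<close> does. This
  links shuffled argument lists to lists with some arguments omitted.\<close>

lemma map_nth_strict_mono_on:
  assumes "strict_mono_on {p..<q} \<sigma>" "\<sigma> ` {p..<q} = {..<length xs} \<inter> A"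
  shows "map (\<lambda>i. xs ! \<sigma> i) [p..<q] = nths xs A"
proof -
  have "sorted_wrt (<) (map \<sigma> [p..<q])"
    unfolding sorted_wrt_map
    by (rule sorted_wrt_mono_rel[OF _ sorted_wrt_upt])
      (use assms(1) in \<open>auto simp: strict_mono_on_def\<close>)
  moreover have "sorted_wrt (<) (filter (\<lambda>i. i \<in> A) [0..<length xs])"
    by (simp add: sorted_wrt_filter)
  ultimately have "map \<sigma> [p..<q] = filter (\<lambda>i. i \<in> A) [0..<length xs]"
    using assms(2) by (intro strict_sorted_equal) auto
  then have "map ((!) xs) (map \<sigma> [p..<q]) = nths xs A" by (simp only: nths_conv_filter_upt)
  then show ?thesis by (simp add: comp_def)
qed

section \<open>Shuffles for special block sizes\<close>

lemma finite_Shuffles [simp]: "finite (Shuffles bs)"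
  by (rule finite_subset[OF _ finite_permutations[of "{..<sum_list bs}"]]) (auto simp: Shuffles_def)

text \<open>An empty block carries no condition. It occurs when all arguments of the outer map are
  filled by other maps.\<close>

lemma Shuffles_snoc_0: "Shuffles (bs @ [0]) = Shuffles bs"
  by (auto simp: Shuffles_def less_Suc_eq)

lemma Shuffles_two:
  "Shuffles [p, q] = {\<sigma>. \<sigma> permutes {..<p + q} \<and> strict_mono_on {..<p} \<sigma> \<and> strict_mono_on {p..<p + q} \<sigma>}"
  by (auto simp: Shuffles_def less_Suc_eq atLeast0LessThan)

lemma Shuffles_one: "Shuffles [n] = {id}"
proof -
  have "\<sigma> = id" if "\<sigma> permutes {..<n}" "strict_mono_on {..<n} \<sigma>" for \<sigma>
    by (rule permutes_eq_if_strict_mono_on[OF _ that(1) _ that(2)])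
      (auto simp: permutes_id strict_mono_on_def)
  then show ?thesis
    by (auto simp: Shuffles_def permutes_id atLeast0LessThan strict_mono_on_def)
qed

text \<open>Monotonicity on a block of size one is vacuous, so only the last block restricts the
  permutation.\<close>

lemma Shuffles_replicate_1:
  "Shuffles (replicate k (Suc 0) @ [m]) = {\<sigma>. \<sigma> permutes {..<k + m} \<and> strict_mono_on {k..<k + m} \<sigma>}"
  by (auto simp: Shuffles_def less_Suc_eq sum_list_replicate strict_mono_on_def All_less_Suc)

text \<open>The cycle by which \<open>permute_list\<close> moves entry \<open>i \<le> b\<close> of a
  list of length \<open>b + 1\<close> to the end, keeping the order of the others.\<close>

definition to_back :: "nat \<Rightarrow> nat \<Rightarrow> nat \<Rightarrow> nat" where
  "to_back b i l = (if l = b then i else if i \<le> l \<and> l < b then Suc l else l)"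

text \<open>The cycle by which \<open>permute_list\<close> moves entry \<open>j\<close> to the
  front, keeping the order of the others.\<close>

definition to_front :: "nat \<Rightarrow> nat \<Rightarrow> nat" where
  "to_front j l = (if l = 0 then j else if l \<le> j then l - 1 else l)"

text \<open>Starting from the identity at \<open>b = i\<close>, each increase of \<open>b\<close>
  contributes one adjacent transposition.\<close>

lemma to_back_permutes_sign:
  assumes "i \<le> b"
  shows "to_back b i permutes {..<Suc b} \<and> sign (to_back b i) = (- 1) ^ (b - i)"
  using assms
proof (induction b rule: dec_induct)
  case base
  have eq: "to_back i i = id" by (auto simp: to_back_def)
  show ?case unfolding eq by (simp add: permutes_def)
next
  case (step b)
  have eq: "to_back (Suc b) i = to_back b i \<circ> transpose b (Suc b)"
    using step(1) by (auto simp: fun_eq_iff to_back_def transpose_def)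
  have t: "transpose b (Suc b) permutes {..<Suc (Suc b)}"
    by (rule permutes_swap_id) auto
  have p: "to_back b i permutes {..<Suc (Suc b)}"
    using step(3) by (meson permutes_subset lessThan_subset_iff le_SucI order_refl)
  have "sign (to_back (Suc b) i) = sign (to_back b i) * sign (transpose b (Suc b))"
    unfolding eq by (rule sign_compose) (use p t in \<open>auto simp: permutation_permutes\<close>)
  moreover have "to_back (Suc b) i permutes {..<Suc (Suc b)}"
    unfolding eq by (rule permutes_compose[OF t p])
  ultimately show ?case using step(1,3) by (simp add: Suc_diff_le sign_swap_id)
qed

lemma to_front_permutes_sign:
  "to_front j permutes {..<Suc j} \<and> sign (to_front j) = (- 1) ^ j"
proof (induction j)
  case 0
  have eq: "to_front 0 = id" by (auto simp: to_front_def)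
  show ?case unfolding eq by (simp add: permutes_def)
next
  case (Suc j)
  have eq: "to_front (Suc j) = transpose j (Suc j) \<circ> to_front j"
    by (auto simp: fun_eq_iff to_front_def transpose_def)
  have t: "transpose j (Suc j) permutes {..<Suc (Suc j)}"
    by (rule permutes_swap_id) auto
  have p: "to_front j permutes {..<Suc (Suc j)}"
    using Suc by (meson permutes_subset lessThan_subset_iff le_SucI order_refl)
  have "sign (to_front (Suc j)) = sign (transpose j (Suc j)) * sign (to_front j)"
    unfolding eq by (rule sign_compose) (use p t in \<open>auto simp: permutation_permutes\<close>)
  moreover have "to_front (Suc j) permutes {..<Suc (Suc j)}"
    unfolding eq by (rule permutes_compose[OF p t])
  ultimately show ?case using Suc by (simp add: sign_swap_id)
qed

text \<open>A shuffle of type \<open>(b, 1)\<close> is determined by its last value, which is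
  arbitrary.\<close>

lemma sum_Shuffles_1:
  "(\<Sum>\<sigma>\<in>Shuffles [b, 1]. F \<sigma>) = (\<Sum>i<Suc b. F (to_back b i))"
proof (rule sum.reindex_bij_witness[where i = "to_back b" and j = "\<lambda>\<sigma>. \<sigma> b"])
  have mono: "strict_mono_on {..<b} (to_back b i)" for i
    by (auto simp: strict_mono_on_def to_back_def)
  fix \<sigma> assume "\<sigma> \<in> Shuffles [b, 1]"
  then have \<sigma>: "\<sigma> permutes {..<Suc b}" "strict_mono_on {..<b} \<sigma>"
    by (auto simp: Shuffles_two)
  show "\<sigma> b \<in> {..<Suc b}" using \<sigma>(1) permutes_in_image by fastforce
  then have p: "to_back b (\<sigma> b) permutes {..<Suc b}" using to_back_permutes_sign[of "\<sigma> b" b] by simp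
  show "to_back b (\<sigma> b) = \<sigma>"
    by (rule permutes_eq_if_strict_mono_on[OF _ p \<sigma>(1) mono \<sigma>(2)])
      (auto simp: to_back_def less_Suc_eq)
  then show "F (to_back b (\<sigma> b)) = F \<sigma>" by simp
next
  fix i assume "i \<in> {..<Suc b}"
  then show "to_back b i \<in> Shuffles [b, 1]"
    using to_back_permutes_sign[of i b] by (auto simp: Shuffles_two strict_mono_on_def to_back_def)
  show "to_back b i b = i" by (simp add: to_back_def)
qed

text \<open>Moving entry \<open>j\<close> to the front shifts entry \<open>i < j\<close> to position
  \<open>Suc i\<close>, from where it is moved to the front in turn. The two cycles consist of
  \<open>j\<close> and \<open>i + 1\<close> adjacent transpositions.\<close>

lemma two_to_front_permutes_sign:
  assumes "i < j" "j < n"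
  shows "to_front j \<circ> to_front (Suc i) permutes {..<n}"
    and "sign (to_front j \<circ> to_front (Suc i)) = (- 1) ^ (i + j + 1)"
    and "strict_mono_on {2..<n} (to_front j \<circ> to_front (Suc i))"
proof -
  have p: "to_front l permutes {..<n}" if "l < n" for l
    using to_front_permutes_sign[of l] that by (meson permutes_subset lessThan_subset_iff Suc_leI)
  have i: "Suc i < n" using assms by simp
  show "to_front j \<circ> to_front (Suc i) permutes {..<n}"
    by (rule permutes_compose[OF p[OF i] p[OF assms(2)]])
  have "sign (to_front j \<circ> to_front (Suc i)) = sign (to_front j) * sign (to_front (Suc i))"
    by (rule sign_compose) (use p i assms(2) in \<open>auto simp: permutation_permutes\<close>)
  then show "sign (to_front j \<circ> to_front (Suc i)) = (- 1) ^ (i + j + 1)"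
    using to_front_permutes_sign by (simp add: power_add)
  show "strict_mono_on {2..<n} (to_front j \<circ> to_front (Suc i))"
    using assms by (auto simp: strict_mono_on_def to_front_def)
qed

text \<open>A shuffle of type \<open>(2, c)\<close> is determined by its first two values, any pair
  \<open>i < j\<close>.\<close>

lemma sum_Shuffles_2:
  "(\<Sum>\<sigma>\<in>Shuffles [2, c]. F \<sigma>) = (\<Sum>j<c + 2. \<Sum>i<j. F (to_front j \<circ> to_front (Suc i)))"
proof -
  let ?P = "\<lambda>(j, i). to_front j \<circ> to_front (Suc i)"
  have "(\<Sum>\<sigma>\<in>Shuffles [2, c]. F \<sigma>) = (\<Sum>p\<in>(SIGMA j:{..<c + 2}. {..<j}). F (?P p))"
  proof (rule sum.reindex_bij_witness[where i = ?P and j = "\<lambda>\<sigma>. (\<sigma> 1, \<sigma> 0)"])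
    fix \<sigma> assume "\<sigma> \<in> Shuffles [2, c]"
    then have \<sigma>: "\<sigma> permutes {..<c + 2}" "strict_mono_on {2..<c + 2} \<sigma>" "\<sigma> 0 < \<sigma> 1"
      by (auto simp: Shuffles_two add.commute strict_mono_on_def)
    moreover have "\<sigma> 1 < c + 2" using permutes_in_image[OF \<sigma>(1), of 1] by simp
    ultimately show "(\<sigma> 1, \<sigma> 0) \<in> (SIGMA j:{..<c + 2}. {..<j})" by auto
    note P = two_to_front_permutes_sign[OF \<sigma>(3) \<open>\<sigma> 1 < c + 2\<close>]
    have "to_front (\<sigma> 1) \<circ> to_front (Suc (\<sigma> 0)) = \<sigma>"
      by (rule permutes_eq_if_strict_mono_on[OF _ P(1) \<sigma>(1) P(3) \<sigma>(2)])
        (use \<sigma>(3) in \<open>auto simp: to_front_def not_le less_2_cases_iff\<close>)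
    then show "?P (\<sigma> 1, \<sigma> 0) = \<sigma>" "F (?P (\<sigma> 1, \<sigma> 0)) = F \<sigma>" by auto
  next
    fix p assume "p \<in> (SIGMA j:{..<c + 2}. {..<j})"
    then obtain i j where p: "p = (j, i)" "i < j" "j < c + 2" by auto
    then show "?P p \<in> Shuffles [2, c]"
      using two_to_front_permutes_sign[of i j "c + 2"]
      by (auto simp: Shuffles_two strict_mono_on_def to_front_def add.commute)
    show "(?P p 1, ?P p 0) = p" using p by (auto simp: to_front_def)
  qed
  also have "\<dots> = (\<Sum>j<c + 2. \<Sum>i<j. F (to_front j \<circ> to_front (Suc i)))"
    by (subst sum.Sigma) (auto simp: case_prod_unfold)
  finally show ?thesis .
qed

text \<open>These shuffles form a single coset: they arise from one of them by permuting the first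
  \<open>k\<close> positions arbitrarily.\<close>

lemma Shuffles_replicate_1_image_card:
  assumes "I \<subseteq> {..<n}" "card I = k"
  shows "card {\<sigma> \<in> Shuffles (replicate k (Suc 0) @ [n - k]). \<sigma> ` {..<k} = I} = fact k"
proof -
  have "finite I" using assms(1) finite_subset by blast
  have k: "k \<le> n" using card_mono[OF _ assms(1)] assms(2) by simp
  \<comment> \<open>The representative \<open>\<tau>\<close> lists \<open>I\<close> and then its
    complement, each in increasing order.\<close>
  define L where "L = sorted_list_of_set I @ sorted_list_of_set ({..<n} - I)"
  define \<tau> where "\<tau> i = (if i < n then L ! i else i)" for i
  have L: "length L = n" "distinct L" "set L = {..<n}"
    using assms \<open>finite I\<close> k by (auto simp: L_def card_Diff_subset)
  have "bij_betw \<tau> {..<n} {..<n}"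
    using bij_betw_nth[OF L(2) L(1)[symmetric, THEN arg_cong[where f = lessThan]] L(3)[symmetric]]
    by (rule bij_betw_cong[THEN iffD1, rotated]) (simp add: \<tau>_def)
  then have \<tau>: "\<tau> permutes {..<n}" by (rule bij_imp_permutes) (simp add: \<tau>_def)
  have nth: "\<tau> i = (if i < k then sorted_list_of_set I ! i else sorted_list_of_set ({..<n} - I) ! (i - k))"
    if "i < n" for i
    using that assms by (simp add: \<tau>_def L_def nth_append)
  have mono: "strict_mono_on {k..<n} \<tau>"
    using assms \<open>finite I\<close> 
    by (auto simp: strict_mono_on_def nth card_Diff_subset intro!: sorted_wrt_nth_less[OF strict_sorted_list_of_set])
  have im: "\<tau> ` {..<k} = I"
  proof -
    have "\<tau> ` {..<k} = (!) (sorted_list_of_set I) ` {..<k}" using k by (intro image_cong) (auto simp: nth)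
    also have "\<dots> = set (sorted_list_of_set I)" using assms by (auto simp: set_conv_nth)
    finally show ?thesis using \<open>finite I\<close> by simp
  qed
  have "{\<sigma> \<in> Shuffles (replicate k (Suc 0) @ [n - k]). \<sigma> ` {..<k} = I} = (\<lambda>\<pi>. \<tau> \<circ> \<pi>) ` {\<pi>. \<pi> permutes {..<k}}"
    (is "?A = _ ` ?B")
  proof (intro equalityI subsetI)
    fix \<sigma> assume "\<sigma> \<in> ?A"
    then have \<sigma>: "\<sigma> permutes {..<n}" "strict_mono_on {k..<n} \<sigma>" "\<sigma> ` {..<k} = I"
      using k by (auto simp: Shuffles_replicate_1)
    have sub: "{k..<n} \<subseteq> {..<n}" "{..<n} - {k..<n} = {..<k}" using k by auto
    have "\<sigma> ` {k..<n} = \<tau> ` {k..<n}"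
      using permutes_image_Compl[OF \<sigma>(1) sub(1)] permutes_image_Compl[OF \<tau> sub(1)] \<sigma>(3) im sub(2) by simp
    \<comment> \<open>On \<open>{k..<n}\<close> both maps are increasing with the same image, and
      from \<open>n\<close> on both are the identity. Hence
      \<open>inv \<tau> \<circ> \<sigma>\<close> moves only the first \<open>k\<close>
      positions.\<close>
    then have eq: "\<sigma> i = \<tau> i" if "k \<le> i" for i
      using strict_mono_on_eq_if_image_eq[OF _ \<sigma>(2) mono] that \<sigma>(1) \<tau>
      by (cases "i < n") (auto simp: permutes_not_in)
    have "inv \<tau> \<circ> \<sigma> permutes {..<k}"
    proof (rule bij_imp_permutes)
      have "(inv \<tau> \<circ> \<sigma>) ` {..<k} = {..<k}"
        using \<sigma>(3) im image_inv_f_f[OF permutes_inj[OF \<tau>]] by (metis image_comp)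
      moreover have "inj (inv \<tau> \<circ> \<sigma>)"
        using \<sigma>(1) \<tau> by (meson inj_compose permutes_inj permutes_inv)
      ultimately show "bij_betw (inv \<tau> \<circ> \<sigma>) {..<k} {..<k}"
        unfolding bij_betw_def by (blast intro: inj_on_subset)
      show "(inv \<tau> \<circ> \<sigma>) i = i" if "i \<notin> {..<k}" for i
        using that eq[of i] permutes_inverses(2)[OF \<tau>] by simp
    qed
    moreover have "\<sigma> = \<tau> \<circ> (inv \<tau> \<circ> \<sigma>)"
      using permutes_inverses(1)[OF \<tau>] by (simp add: fun_eq_iff)
    ultimately show "\<sigma> \<in> (\<lambda>\<pi>. \<tau> \<circ> \<pi>) ` ?B" by blast
  next
    fix \<sigma> assume "\<sigma> \<in> (\<lambda>\<pi>. \<tau> \<circ> \<pi>) ` ?B"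
    then obtain \<pi> where \<pi>: "\<pi> permutes {..<k}" "\<sigma> = \<tau> \<circ> \<pi>" by auto
    have "\<pi> permutes {..<n}" using \<pi>(1) k by (meson permutes_subset lessThan_subset_iff)
    then have "\<sigma> permutes {..<n}" using \<pi>(2) \<tau> permutes_compose by blast
    moreover have "strict_mono_on {k..<n} \<sigma>"
      using mono \<pi> by (auto simp: strict_mono_on_def permutes_not_in)
    moreover have "\<sigma> ` {..<k} = I"
      using \<pi> im by (metis image_comp permutes_image)
    ultimately show "\<sigma> \<in> ?A" using k by (simp add: Shuffles_replicate_1)
  qed
  moreover have "inj_on (\<lambda>\<pi>. \<tau> \<circ> \<pi>) ?B"
    using fun.inj_map[OF permutes_inj[OF \<tau>]] by (rule inj_on_subset) simp
  ultimately show ?thesis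
    by (simp add: card_image card_permutations[of "{..<k}" k])
qed

text \<open>Grouping the shuffles by the image of the first \<open>k\<close> positions gives one
  fibre of size \<open>k!\<close> for each \<open>k\<close>-element set.\<close>

lemma (in vector_space) sum_Shuffles_replicate_1:
  assumes "k \<le> n"
  shows "(\<Sum>\<sigma>\<in>Shuffles (replicate k (Suc 0) @ [n - k]). F (\<sigma> ` {..<k}))
    = (\<Sum>I | I \<subseteq> {..<n} \<and> card I = k. scale (of_nat (fact k)) (F I))"
proof -
  let ?S = "Shuffles (replicate k (Suc 0) @ [n - k])" and ?T = "{I. I \<subseteq> {..<n} \<and> card I = k}"
  have "(\<lambda>\<sigma>. \<sigma> ` {..<k}) ` ?S \<subseteq> ?T"
  proof safe
    fix \<sigma> i assume "\<sigma> \<in> ?S"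
    then have \<sigma>: "\<sigma> permutes {..<n}" using assms by (simp add: Shuffles_replicate_1)
    show "i < k \<Longrightarrow> \<sigma> i < n" using permutes_in_image[OF \<sigma>, of i] assms by auto
    show "card (\<sigma> ` {..<k}) = k" using card_image[OF inj_on_subset[OF permutes_inj[OF \<sigma>]], of "{..<k}"] by simp
  qed
  then have "(\<Sum>\<sigma>\<in>?S. F (\<sigma> ` {..<k})) = (\<Sum>I\<in>?T. \<Sum>\<sigma>\<in>{\<sigma> \<in> ?S. \<sigma> ` {..<k} = I}. F (\<sigma> ` {..<k}))"
    by (subst sum.group) auto
  also have "\<dots> = (\<Sum>I\<in>?T. scale (of_nat (fact k)) (F I))"
  proof (rule sum.cong[OF refl])
    fix I assume I: "I \<in> ?T"
    have "(\<Sum>\<sigma>\<in>{\<sigma> \<in> ?S. \<sigma> ` {..<k} = I}. F (\<sigma> ` {..<k})) = (\<Sum>\<sigma>\<in>{\<sigma> \<in> ?S. \<sigma> ` {..<k} = I}. F I)"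
      by (rule sum.cong) auto
    also have "\<dots> = scale (of_nat (fact k)) (F I)"
      using Shuffles_replicate_1_image_card[of I n k] I by (simp add: sum_constant_scale)
    finally show "(\<Sum>\<sigma>\<in>{\<sigma> \<in> ?S. \<sigma> ` {..<k} = I}. F (\<sigma> ` {..<k})) = scale (of_nat (fact k)) (F I)" .
  qed
  finally show ?thesis .
qed

section \<open>Argument lists after a shuffle\<close>

lemma permute_list_to_back:
  assumes "i \<le> b" "length xs = Suc b"
  shows "permute_list (to_back b i) xs = nths xs (- {i}) @ [xs ! i]"
proof -
  have "to_back b i ` {0..<b} = {..<Suc b} - to_back b i ` ({..<Suc b} - {0..<b})"
    by (rule permutes_image_Compl) (use to_back_permutes_sign[OF assms(1)] in auto)
  also have "{..<Suc b} - {0..<b} = {b}" by auto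
  finally have "to_back b i ` {0..<b} = {..<length xs} \<inter> - {i}"
    using assms by (auto simp: to_back_def)
  moreover have "strict_mono_on {0..<b} (to_back b i)"
    by (auto simp: strict_mono_on_def to_back_def)
  ultimately have "map (\<lambda>l. xs ! to_back b i l) [0..<b] = nths xs (- {i})"
    by (intro map_nth_strict_mono_on)
  then show ?thesis using assms by (simp add: permute_list_def to_back_def)
qed

lemma permute_list_two_to_front:
  assumes "i < j" "j < length xs"
  shows "permute_list (to_front j \<circ> to_front (Suc i)) xs = xs ! i # xs ! j # nths xs (- {i, j})"
proof -
  let ?\<sigma> = "to_front j \<circ> to_front (Suc i)" and ?n = "length xs"
  have "?\<sigma> ` {2..<?n} = {..<?n} - ?\<sigma> ` ({..<?n} - {2..<?n})"
    by (rule permutes_image_Compl) (use two_to_front_permutes_sign(1)[OF assms] in auto)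
  also have "{..<?n} - {2..<?n} = {0, 1}" using assms by auto
  finally have "?\<sigma> ` {2..<?n} = {..<?n} \<inter> - {i, j}"
    using assms by (auto simp: to_front_def)
  then have "map (\<lambda>l. xs ! ?\<sigma> l) [2..<?n] = nths xs (- {i, j})"
    by (intro map_nth_strict_mono_on two_to_front_permutes_sign(3) assms)
  moreover have "xs \<noteq> []" using assms by auto
  moreover from this have "[0..<?n] = 0 # 1 # [2..<?n]"
    using assms by (simp add: upt_conv_Cons numeral_2_eq_2)
  ultimately show ?thesis using assms by (simp add: permute_list_def to_front_def)
qed

section \<open>The operations evaluated at the bracket and the derivation\<close>

lemma power_int_minus_one: "(- 1 :: 'a::field) powi m = (if even m then 1 else - 1)"
  by (simp add: power_int_minus_left)

lemma apply_blocks_replicate_cochain1: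
  "k \<le> length xs \<Longrightarrow> apply_blocks (replicate k (Suc 0, cochain1 d)) xs = map d (take k xs) @ drop k xs"
proof (induction k arbitrary: xs)
  case (Suc k)
  then show ?case by (cases xs) (simp_all add: cochain1_def)
qed simp

text \<open>No subset is that large. Thus one formula also covers more copies of \<open>d\<close>
  than \<open>f\<close> has arguments.\<close>

lemma sum_card_subsets_eq_0:
  assumes "n < k"
  shows "(\<Sum>I | I \<subseteq> {..<n} \<and> card I = k. F I) = 0"
proof -
  have "card I \<noteq> k" if "I \<subseteq> {..<n}" for I
    using card_mono[OF finite_lessThan that] assms by simp
  then have empty: "{I. I \<subseteq> {..<n} \<and> card I = k} = {}"
    by blast
  show ?thesis unfolding empty by simp
qed

text \<open>Copies of \<open>d\<close> have degree 0, so inserting them produces neither kind of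
  sign.\<close>

lemma exponent_replicate_0:
  "l_exponent (replicate k 0) = 0" "koszul_exponent (replicate k 0) = 0"
  by (simp_all add: l_exponent_def koszul_exponent_def)

section \<open>Alternating maps and insertion of copies of \<open>d\<close>\<close>

context vector_space
begin

text \<open>Polarisation: put the sum of the two entries into both slots and expand; only the two
  mixed terms survive.\<close>

lemma Hom_alt_transpose:
  assumes f: "f \<in> Hom_alt scale n" and len: "length xs = n" and "i < n" "j < n" "i \<noteq> j"
  shows "f (permute_list (transpose i j) xs) = - f xs"
proof -
  define h where "h a b = f (xs[i := a, j := b])" for a b
  have lin: "f (ys[l := x + y]) = f (ys[l := x]) + f (ys[l := y])"
    if "length ys = n" "l < n" for ys l x y
    using f that by (auto simp: Hom_alt_def Vector_Spaces.linear_iff)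
  have add: "h (a + a') b = h a b + h a' b" "h a (b + b') = h a b + h a b'" for a a' b b'
    using assms(2-) lin[of "xs[j := b]" i] lin[of "xs[i := a]" j]
    by (auto simp: h_def list_update_swap)
  have alt: "h a a = 0" for a
  proof -
    have "f ys = 0" if "length ys = n" "a < b" "b < n" "ys ! a = ys ! b" for ys a b
      using f that by (simp add: Hom_alt_def)
    then have "f ys = 0" if "length ys = n" "ys ! i = ys ! j" for ys
      using that assms(3-) by (metis linorder_neqE_nat)
    then show ?thesis using assms(2-) by (simp add: h_def nth_list_update)
  qed
  have "h (xs ! i + xs ! j) (xs ! i + xs ! j) = h (xs ! i) (xs ! j) + h (xs ! j) (xs ! i)"
    by (simp only: add) (simp add: alt)
  then have "h (xs ! j) (xs ! i) = - h (xs ! i) (xs ! j)"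
    by (simp add: alt add_eq_0_iff)
  moreover have "permute_list (transpose i j) xs = xs[i := xs ! j, j := xs ! i]"
    using assms(2-) by (auto intro!: nth_equalityI simp: permute_list_def nth_list_update transpose_def)
  ultimately show ?thesis by (simp add: h_def)
qed

lemma Hom_alt_permute:
  assumes "\<sigma> permutes {..<n}" and f: "f \<in> Hom_alt scale n" and "length xs = n"
  shows "f (permute_list \<sigma> xs) = scale (of_int (sign \<sigma>)) (f xs)"
proof -
  have "\<forall>xs. length xs = n \<longrightarrow> f (permute_list \<sigma> xs) = scale (of_int (sign \<sigma>)) (f xs)"
    using assms(1) finite_lessThan
  proof (induction rule: permutes_induct)
    case id
    then show ?case by simp
  next
    case (swap a b p)
    have p: "p permutes {..<n}" using swap by blast
    then have "permutation p" using permutation_permutes by blast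
    then have "sign (transpose a b \<circ> p) = sign (transpose a b) * sign p"
      by (intro sign_compose permutation_swap_id)
    then have "sign (transpose a b \<circ> p) = - sign p"
      using swap(3) by (simp add: sign_swap_id)
    moreover have "f (permute_list (transpose a b \<circ> p) xs) = scale (- of_int (sign p)) (f xs)"
      if len: "length xs = n" for xs
    proof -
      have "permute_list (transpose a b \<circ> p) xs = permute_list p (permute_list (transpose a b) xs)"
        by (rule permute_list_compose) (use p len in simp)
      moreover have "f (permute_list p ys) = scale (of_int (sign p)) (f ys)" if "length ys = n" for ys
        using swap that by blast
      moreover have "f (permute_list (transpose a b) xs) = - f xs"
        using swap len by (intro Hom_alt_transpose[OF f]) auto
      ultimately show ?thesis using len by simp
    qed
    ultimately show ?case unfolding comp_def by simp
  qed
  then show ?thesis using assms(3) by simp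
qed

text \<open>The sign of the shuffle cancels against the one that \<open>f\<close> picks up when its arguments are
  put back into their original order.\<close>

lemma sum_Shuffles_Hom_alt:
  assumes f: "f \<in> Hom_alt scale n" and len: "length xs = n" and k: "k \<le> n"
  shows "(\<Sum>\<sigma>\<in>Shuffles (replicate k (Suc 0) @ [n - k]). scale (of_int (sign \<sigma>))
      (f (map d (take k (permute_list \<sigma> xs)) @ drop k (permute_list \<sigma> xs))))
    = scale (of_nat (fact k)) (\<Sum>I | I \<subseteq> {..<n} \<and> card I = k.
        f (map (\<lambda>i. if i \<in> I then d (xs ! i) else xs ! i) [0..<n]))"
proof -
  let ?u = "\<lambda>I. map (\<lambda>i. if i \<in> I then d (xs ! i) else xs ! i) [0..<n]"
  have "scale (of_int (sign \<sigma>)) (f (map d (take k (permute_list \<sigma> xs)) @ drop k (permute_list \<sigma> xs)))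
      = f (?u (\<sigma> ` {..<k}))" if "\<sigma> \<in> Shuffles (replicate k (Suc 0) @ [n - k])" for \<sigma>
  proof -
    have \<sigma>: "\<sigma> permutes {..<n}" using that k by (simp add: Shuffles_replicate_1)
    have "map d (take k (permute_list \<sigma> xs)) @ drop k (permute_list \<sigma> xs)
        = permute_list \<sigma> (?u (\<sigma> ` {..<k}))"
    proof (rule nth_equalityI)
      fix i assume "i < length (map d (take k (permute_list \<sigma> xs)) @ drop k (permute_list \<sigma> xs))"
      then have "i < n" using len by simp
      moreover have "\<sigma> i < n" using permutes_in_image[OF \<sigma>, of i] \<open>i < n\<close> by simp
      \<comment> \<open>By injectivity, \<open>d\<close> hits exactly the arguments read in the
        first \<open>k\<close> places.\<close>
      moreover have "\<sigma> i \<in> \<sigma> ` {..<k} \<longleftrightarrow> i < k"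
        using inj_image_mem_iff[OF permutes_inj[OF \<sigma>]] by simp
      ultimately show "(map d (take k (permute_list \<sigma> xs)) @ drop k (permute_list \<sigma> xs)) ! i
          = permute_list \<sigma> (?u (\<sigma> ` {..<k})) ! i"
        using len k \<sigma> by (simp add: nth_append permute_list_nth)
    qed (use len in simp)
    then show ?thesis
      using Hom_alt_permute[OF \<sigma> f, of "?u (\<sigma> ` {..<k})"] by (simp flip: of_int_mult)
  qed
  then have "(\<Sum>\<sigma>\<in>Shuffles (replicate k (Suc 0) @ [n - k]). scale (of_int (sign \<sigma>))
      (f (map d (take k (permute_list \<sigma> xs)) @ drop k (permute_list \<sigma> xs))))
    = (\<Sum>\<sigma>\<in>Shuffles (replicate k (Suc 0) @ [n - k]). f (?u (\<sigma> ` {..<k})))"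
    by (rule sum.cong[OF refl])
  also have "\<dots> = scale (of_nat (fact k)) (\<Sum>I | I \<subseteq> {..<n} \<and> card I = k. f (?u I))"
    by (simp add: sum_Shuffles_replicate_1[OF k, of "\<lambda>I. f (?u I)"] scale_sum_right)
  finally show ?thesis .
qed

text \<open>For \<open>k \<ge> 1\<close> this is \<open>k!\<close> times the summand of
  \<open>delta\<close> with \<open>k\<close> copies of \<open>d\<close>. The term
  \<open>- d (f xs)\<close> appears only at \<open>k = 1\<close>, as the second half of the
  Nijenhuis-Richardson bracket.\<close>

lemma l_mixed_replicate_cochain1:
  assumes f: "f \<in> Hom_alt scale n" and "1 \<le> n"
  shows "l_mixed scale lam n f (replicate k (1, cochain1 d)) xs = (if length xs = n then
      (if k = 0 then 0 else scale (of_nat (fact k) * lam ^ (k - 1)) (\<Sum>I | I \<subseteq> {..<n} \<and> card I = k.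
        f (map (\<lambda>i. if i \<in> I then d (xs ! i) else xs ! i) [0..<n])))
      - (if k = 1 then d (f xs) else 0) else 0)"
proof -
  consider "k = 0" | "k = 1" | "2 \<le> k" by linarith
  then show ?thesis
  proof cases
    case 1
    then show ?thesis by (simp add: l_mixed_def l_higher_def)
  next
    case 2
    have take: "take (Suc 0) ys = [ys ! 0]" if "length ys = n" for ys :: "'b list"
      using that assms(2) by (cases ys) auto
    have "nr_comp scale n 1 f (cochain1 d) xs = (\<Sum>\<sigma>\<in>Shuffles (replicate 1 (Suc 0) @ [n - 1]).
        scale (of_int (sign \<sigma>)) (f (map d (take 1 (permute_list \<sigma> xs)) @ drop 1 (permute_list \<sigma> xs))))"
      if "length xs = n"
      unfolding nr_comp_def using that assms(2)
      by (auto simp: Let_def cochain1_def take simp del: take_Suc drop_Suc intro!: sum.cong)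
    \<comment> \<open>The only argument of \<open>d\<close> is filled by \<open>f\<close>, so the
      second block is empty and the identity is the only shuffle.\<close>
    moreover have "nr_comp scale 1 n (cochain1 d) f xs = d (f xs)" if "length xs = n"
      using that Shuffles_snoc_0[of "[n]"] by (simp add: nr_comp_def Shuffles_one cochain1_def)
    moreover have "nr_comp scale n 1 f (cochain1 d) xs = 0" "nr_comp scale 1 n (cochain1 d) f xs = 0"
      if "length xs \<noteq> n" using that by (simp_all add: nr_comp_def)
    ultimately show ?thesis
      using 2 assms(2) sum_Shuffles_Hom_alt[OF f, of xs 1 d]
      by (simp add: l_mixed_def nr_bracket_def)
  next
    case 3
    then obtain j where j: "k = Suc (Suc j)" by (metis add_2_eq_Suc le_Suc_ex)
    have "l_mixed scale lam n f (replicate k (1, cochain1 d)) = l_higher scale lam n f (replicate k (1, cochain1 d))"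
      by (simp add: l_mixed_def j)
    moreover have "l_higher scale lam n f (replicate k (1, cochain1 d)) xs
        = scale (of_nat (fact k) * lam ^ (k - 1)) (\<Sum>I | I \<subseteq> {..<n} \<and> card I = k.
          f (map (\<lambda>i. if i \<in> I then d (xs ! i) else xs ! i) [0..<n]))"
      if len: "length xs = n" and k: "k \<le> n"
    proof -
      have h: "l_higher scale lam n f (replicate k (1, cochain1 d)) xs
        = (\<Sum>\<sigma>\<in>Shuffles (replicate k (Suc 0) @ [n - k]). scale (lam ^ (k - 1)) (scale (of_int (sign \<sigma>))
            (f (map d (take k (permute_list \<sigma> xs)) @ drop k (permute_list \<sigma> xs)))))"
        using that 3
        by (simp add: l_higher_def Let_def sum_list_replicate exponent_replicate_0
            apply_blocks_replicate_cochain1)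
      show ?thesis
        unfolding h scale_sum_right[symmetric] sum_Shuffles_Hom_alt[OF f len k] by (simp add: mult.commute)
    qed
    moreover have "(\<Sum>I | I \<subseteq> {..<n} \<and> card I = k.
        f (map (\<lambda>i. if i \<in> I then d (xs ! i) else xs ! i) [0..<n])) = 0" if "\<not> k \<le> n"
      using that by (intro sum_card_subsets_eq_0) simp
    moreover have "l_higher scale lam n f (replicate k (1, cochain1 d)) xs = 0"
      if "length xs \<noteq> n \<or> \<not> k \<le> n"
      using that by (auto simp: l_higher_def Let_def sum_list_replicate)
    ultimately show ?thesis using 3 by (cases "length xs = n"; cases "k \<le> n") simp_all
  qed
qed

text \<open>The argument from \<open>sM\<close> is either one of the \<open>k\<close> copies of
  \<open>\<mu>\<close>, all giving the same term, or it is \<open>f\<close>. The copies have degree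
  0, so graded symmetry gives no sign.\<close>

lemma snd_l_op_replicate:
  "snd (l_op scale lam (replicate k (0, \<mu>, D) @ [(e, f, g)])) xs
    = scale (of_nat k) (l_mixed scale lam 2 \<mu> (replicate (k - 1) (1, D) @ [(nat (e + 1), g)]) xs)
      + l_mixed scale lam (nat (e + 2)) f (replicate k (1, D)) xs"
proof -
  let ?es = "replicate k (0, \<mu>, D) @ [(e, f, g)]"
  have "(\<Sum>p<k. case ?es ! p of (e, f, _) \<Rightarrow>
        scale ((- 1) powi (e * (\<Sum>q<p. fst (?es ! q)))) (l_mixed scale lam (nat (e + 2)) f
             (map (\<lambda>(e', _, \<xi>). (nat (e' + 1), \<xi>)) (take p ?es @ drop (Suc p) ?es)) xs))
      = (\<Sum>p<k. l_mixed scale lam 2 \<mu> (replicate (k - 1) (1, D) @ [(nat (e + 1), g)]) xs)"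
  proof (rule sum.cong[OF refl])
    fix p assume "p \<in> {..<k}"
    then have p: "p < k" by simp
    have "replicate p x @ replicate (k - Suc p) x = replicate (k - 1) x" for x :: "nat \<times> ('b list \<Rightarrow> 'b)"
      using p by (simp flip: replicate_add)
    then have eq: "map (\<lambda>(e', _, \<xi>). (nat (e' + 1), \<xi>)) (take p ?es @ drop (Suc p) ?es)
        = replicate (k - 1) (1, D) @ [(nat (e + 1), g)]"
      using p by (simp flip: append_assoc)
    show "(case ?es ! p of (e, f, _) \<Rightarrow>
        scale ((- 1) powi (e * (\<Sum>q<p. fst (?es ! q)))) (l_mixed scale lam (nat (e + 2)) f
             (map (\<lambda>(e', _, \<xi>). (nat (e' + 1), \<xi>)) (take p ?es @ drop (Suc p) ?es)) xs))
      = l_mixed scale lam 2 \<mu> (replicate (k - 1) (1, D) @ [(nat (e + 1), g)]) xs"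
      unfolding eq using p by (simp add: nth_append)
  qed
  moreover have "(\<Sum>q<k. fst (?es ! q)) = 0" by (simp add: nth_append)
  ultimately show ?thesis
    by (simp add: l_op_def nth_append sum_constant_scale)
qed

text \<open>Only \<open>l_2\<close> has a component in \<open>sM\<close>; the minus sign is
  \<open>(-1)^{|f|}\<close> for \<open>\<mu>\<close>, of degree 1.\<close>

lemma fst_l_op_replicate:
  "fst (l_op scale lam (replicate k (0, \<mu>, D) @ [(e, f, g)])) xs
    = (if k = 1 then - nr_bracket scale 2 (nat (e + 2)) \<mu> f xs else 0)"
proof -
  consider "k = 0" | "k = 1" | j where "k = Suc (Suc j)" by (metis One_nat_def not0_implies_Suc)
  then show ?thesis by cases (auto simp: l_op_def split: list.split)
qed

end

section \<open>The bracket and the Chevalley-Eilenberg differentials\<close>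

context lie_algebra
begin

lemma br_add_left: "br (x + y) z = br x z + br y z"
  and br_scale_left: "br (scale c x) z = scale c (br x z)"
  using linear_left by (simp_all add: Vector_Spaces.linear_iff)

lemma br_add_right: "br z (x + y) = br z x + br z y"
  using linear_right by (simp add: Vector_Spaces.linear_iff)

lemma br_swap: "br y x = - br x y"
proof -
  have "br (x + y) (x + y) = br x y + br y x"
    by (simp only: br_add_left br_add_right) (simp add: br_self)
  then show ?thesis by (simp add: br_self add_eq_0_iff)
qed

lemma cochain2_Hom_alt: "cochain2 br \<in> Hom_alt scale 2"
proof -
  have "Vector_Spaces.linear scale scale (\<lambda>x. cochain2 br (xs[i := x]))" if "length xs = 2" "i < 2" for xs i
    using that linear_left linear_right by (auto simp: cochain2_def less_2_cases_iff)
  moreover have "cochain2 br xs = 0" if "i < j" "j < 2" "xs ! i = xs ! j" for xs i j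
    using that by (auto simp: cochain2_def less_2_cases_iff br_self)
  moreover have "cochain2 br xs = 0" if "length xs \<noteq> 2" for xs
    using that by (simp add: cochain2_def)
  ultimately show ?thesis unfolding Hom_alt_def by blast
qed

text \<open>Argument \<open>i\<close> goes to the end with sign \<open>(- 1) ^ (b - i)\<close>;
  antisymmetry of \<open>br\<close> brings it to the first slot with one more sign. The map
  \<open>h\<close> will be \<open>id\<close> for the adjoint action and \<open>d\<close> for its
  weighted correction.\<close>

lemma sum_Shuffles_br:
  assumes "length xs = b + 1"
  shows "(\<Sum>\<sigma>\<in>Shuffles [b, 1]. scale (of_int (sign \<sigma>))
      (br (g (take b (permute_list \<sigma> xs))) (h (drop b (permute_list \<sigma> xs) ! 0))))
    = (\<Sum>i<b + 1. scale ((- 1) ^ (Suc i + b)) (br (h (xs ! i)) (g (nths xs (- {i})))))"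
proof -
  have eq: "scale (of_int (sign (to_back b i)))
      (br (g (take b (permute_list (to_back b i) xs))) (h (drop b (permute_list (to_back b i) xs) ! 0)))
    = scale ((- 1) ^ (Suc i + b)) (br (h (xs ! i)) (g (nths xs (- {i}))))" if "i \<le> b" for i
  proof -
    note p = permute_list_to_back[OF that, of xs]
    have "length (nths xs (- {i})) = b"
      using arg_cong[OF p, of length] assms by simp
    moreover have "(- 1 :: 'k) ^ (b - i) = - ((- 1) ^ (Suc i + b))"
      using that by (simp add: minus_one_power_iff)
    ultimately show ?thesis
      using p assms to_back_permutes_sign[OF that] br_swap[of "h (xs ! i)"] by simp
  qed
  show ?thesis
    unfolding sum_Shuffles_1 Suc_eq_plus1[symmetric]
    by (rule sum.cong) (simp_all only: eq lessThan_iff less_Suc_eq_le)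
qed

text \<open>Inserting \<open>g\<close> into the bracket gives the terms with the adjoint action,
  over shuffles of type \<open>(b, 1)\<close>; inserting the bracket into \<open>g\<close> gives
  those with \<open>[x_i, x_j]\<close>, over shuffles of type \<open>(2, b - 1)\<close>.\<close>

lemma nr_bracket_cochain2: "nr_bracket scale 2 b (cochain2 br) g = d_Lie scale br b g"
proof
  fix xs
  show "nr_bracket scale 2 b (cochain2 br) g xs = d_Lie scale br b g xs"
  proof (cases "length xs = b + 1")
    case False
    then show ?thesis by (simp add: nr_bracket_def nr_comp_def d_Lie_def dCE_def)
  next
    case len: True
    have "nr_comp scale 2 b (cochain2 br) g xs = (\<Sum>\<sigma>\<in>Shuffles [b, 1]. scale (of_int (sign \<sigma>))
      (br (g (take b (permute_list \<sigma> xs))) (id (drop b (permute_list \<sigma> xs) ! 0))))"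
      using len by (simp add: nr_comp_def cochain2_def Let_def)
    also have "\<dots> = (\<Sum>i<b + 1. scale ((- 1) ^ (Suc i + b)) (br (xs ! i) (g (nths xs (- {i})))))"
      by (subst sum_Shuffles_br[OF len]) simp
    finally have 1: "nr_comp scale 2 b (cochain2 br) g xs = \<dots>" .
    have 2: "scale ((- 1) powi ((int 2 - 1) * (int b - 1))) (nr_comp scale b 2 g (cochain2 br) xs)
      = - (\<Sum>j<b + 1. \<Sum>i<j. scale ((- 1) ^ (Suc i + Suc j + b + 1)) (g (br (xs ! i) (xs ! j) # nths xs (- {i, j}))))"
    \<comment> \<open>For \<open>b = 0\<close> there is no slot for the bracket, and the double sum
      is empty as well.\<close>
    proof (cases b)
      case 0
      then show ?thesis by (simp add: nr_comp_def)
    next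
      case (Suc c)
      have "nr_comp scale b 2 g (cochain2 br) xs = (\<Sum>\<sigma>\<in>Shuffles [2, c]. scale (of_int (sign \<sigma>))
          (g (cochain2 br (take 2 (permute_list \<sigma> xs)) # drop 2 (permute_list \<sigma> xs))))"
        using len Suc by (simp add: nr_comp_def Let_def)
      also have "\<dots> = (\<Sum>j<b + 1. \<Sum>i<j. scale ((- 1) ^ (i + j + 1)) (g (br (xs ! i) (xs ! j) # nths xs (- {i, j}))))"
        unfolding sum_Shuffles_2 using len Suc
        by (intro sum.cong)
          (auto simp: permute_list_two_to_front two_to_front_permutes_sign(2)[of _ _ "b + 1"] cochain2_def numeral_2_eq_2)
      finally have nr: "nr_comp scale b 2 g (cochain2 br) xs = \<dots>" .
      \<comment> \<open>The bracket has degree 1 and \<open>g\<close> degree \<open>b - 1\<close>;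
        the minus sign left over cancels the one in \<open>nr_bracket\<close>.\<close>
      have sgn: "(- 1 :: 'k) powi ((int 2 - 1) * (int b - 1)) * (- 1) ^ (i + j + 1)
          = - ((- 1) ^ (Suc i + Suc j + b + 1))" for i j
        by (simp add: Suc power_int_minus_one minus_one_power_iff)
      show ?thesis
        unfolding nr scale_sum_right sum_negf[symmetric]
        by (intro sum.cong refl) (simp only: scale_scale sgn scale_minus_left)
    qed
    show ?thesis unfolding nr_bracket_def 1 2 using len by (simp add: d_Lie_def dCE_def)
  qed
qed

text \<open>The two operators differ by the action of \<open>scale lam (d x)\<close>, which affects
  only the first sum of \<open>dCE\<close>. This difference is the sum over
  \<open>(b, 1)\<close>-shuffles that defines \<open>l_3\<close> on the bracket, \<open>d\<close>
  and \<open>g\<close>.\<close>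

lemma d_DO_conv_l_higher:
  "d_DO scale br lam d b g xs
    = d_Lie scale br b g xs + l_higher scale lam 2 (cochain2 br) [(1, cochain1 d), (b, g)] xs"
proof (cases "length xs = b + 1")
  case False
  then show ?thesis by (simp add: d_DO_def d_Lie_def dCE_def l_higher_def)
next
  case len: True
  have exps: "l_exponent [0, m] = 0" "koszul_exponent [0, m] = 0" for m
    by (simp_all add: l_exponent_def koszul_exponent_def)
  have "l_higher scale lam 2 (cochain2 br) [(1, cochain1 d), (b, g)] xs
    = (\<Sum>\<sigma>\<in>Shuffles [b, 1]. scale lam (scale (of_int (sign \<sigma>))
      (br (g (take b (permute_list \<sigma> xs))) (d (drop b (permute_list \<sigma> xs) ! 0)))))"
    using len Shuffles_snoc_0[of "[b, 1]"]
    by (simp add: l_higher_def Let_def exps cochain2_def cochain1_def)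
  also have "\<dots> = (\<Sum>i<b + 1. scale ((- 1) ^ (Suc i + b)) (br (scale lam (d (xs ! i))) (g (nths xs (- {i})))))"
    unfolding scale_sum_right[symmetric] sum_Shuffles_br[OF len]
    unfolding scale_sum_right by (simp only: br_scale_left scale_scale mult.commute)
  finally have h: "l_higher scale lam 2 (cochain2 br) [(1, cochain1 d), (b, g)] xs = \<dots>" .
  have "(\<Sum>i<b + 1. scale ((- 1) ^ (Suc i + b)) (br (xs ! i + scale lam (d (xs ! i))) (g (nths xs (- {i})))))
    = (\<Sum>i<b + 1. scale ((- 1) ^ (Suc i + b)) (br (xs ! i) (g (nths xs (- {i})))))
      + l_higher scale lam 2 (cochain2 br) [(1, cochain1 d), (b, g)] xs"
    unfolding h by (simp only: br_add_left scale_right_distrib sum.distrib)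
  then show ?thesis
    using len by (simp only: d_DO_def d_Lie_def dCE_def if_True add_ac refl)
qed

end

section \<open>Sums over all operations\<close>

lemma sum_fun_apply: "(\<Sum>k\<in>A. F k) x = (\<Sum>k\<in>A. F k x)"
  by (induction A rule: infinite_finite_induct) auto

text \<open>\<open>Sum_any\<close> is 0 by convention on infinite support. A bound \<open>N\<close>
  uniform in \<open>xs\<close> makes it a finite sum of pairs of functions, which can be evaluated
  termwise.\<close>

lemma Sum_any_cochain_apply:
  fixes t :: "nat \<Rightarrow> 'g::ab_group_add cochain \<times> 'g cochain"
  assumes "\<And>k xs. N < k \<Longrightarrow> fst (t k) xs = 0" "\<And>k xs. N < k \<Longrightarrow> snd (t k) xs = 0"
  shows "fst (Sum_any t) xs = (\<Sum>k\<le>N. fst (t k) xs)" "snd (Sum_any t) xs = (\<Sum>k\<le>N. snd (t k) xs)"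
proof -
  have "t k = 0" if "N < k" for k
    using assms[OF that] by (simp add: prod_eq_iff fun_eq_iff)
  then have "Sum_any t = (\<Sum>k\<le>N. t k)"
    by (intro Sum_any.expand_superset) (auto simp: not_less[symmetric])
  then show "fst (Sum_any t) xs = (\<Sum>k\<le>N. fst (t k) xs)" "snd (Sum_any t) xs = (\<Sum>k\<le>N. snd (t k) xs)"
    by (simp_all add: fst_sum snd_sum sum_fun_apply)
qed

lemma l_mixed_eq_0:
  assumes "1 < length \<xi>s" "a < length \<xi>s"
  shows "l_mixed scale lam a f \<xi>s xs = 0"
proof -
  obtain x y zs where "\<xi>s = x # y # zs" using assms(1) by (cases \<xi>s; cases "tl \<xi>s") auto
  then show ?thesis using assms(2) by (simp add: l_mixed_def l_higher_def split_beta)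
qed

text \<open>The factor \<open>1 / fact k\<close> cancels the number of shuffles per set of
  positions. Summands with \<open>n < k\<close> vanish, so \<open>N\<close> is free: it is
  \<open>2\<close> for the Maurer-Cartan equation and \<open>n + 2\<close> for the
  differential.\<close>

lemma sum_l_mixed_replicate_cochain1:
  fixes scale :: "'k::field_char_0 \<Rightarrow> 'g::ab_group_add \<Rightarrow> 'g"
  assumes "vector_space scale" and f: "f \<in> Hom_alt scale n" and n: "1 \<le> n" "n \<le> N"
  shows "(\<Sum>k\<le>N. scale (1 / fact k) (l_mixed scale lam n f (replicate k (1, cochain1 d)) xs))
    = delta scale lam d n f xs"
proof -
  interpret vector_space scale by fact
  show ?thesis
  proof (cases "length xs = n")
    case False
    then show ?thesis
      by (simp only: l_mixed_replicate_cochain1[OF f n(1)] delta_def if_False scale_zero_right sum.neutral_const)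
  next
    case True
    let ?S = "\<lambda>k. \<Sum>I | I \<subseteq> {..<n} \<and> card I = k.
      f (map (\<lambda>i. if i \<in> I then d (xs ! i) else xs ! i) [0..<n])"
    have S: "?S k = 0" if "n < k" for k
      using that by (rule sum_card_subsets_eq_0)
    have eq: "scale (1 / fact k) (l_mixed scale lam n f (replicate k (1, cochain1 d)) xs)
      = (if k = 0 then 0 else scale (lam ^ (k - 1)) (?S k)) - (if k = 1 then d (f xs) else 0)" for k
      unfolding l_mixed_replicate_cochain1[OF f n(1)] if_P[OF True] by (simp add: scale_right_diff_distrib)
    have "(\<Sum>k\<le>N. scale (1 / fact k) (l_mixed scale lam n f (replicate k (1, cochain1 d)) xs))
      = (\<Sum>k\<le>N. if k = 0 then 0 else scale (lam ^ (k - 1)) (?S k)) - (\<Sum>k\<le>N. if k = 1 then d (f xs) else 0)"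
      by (simp only: eq sum_subtractf)
    also have "(\<Sum>k\<le>N. if k = 0 then 0 else scale (lam ^ (k - 1)) (?S k)) = (\<Sum>k = 1..n. scale (lam ^ (k - 1)) (?S k))"
      using n(2) S by (intro sum.mono_neutral_cong_right) (auto simp: not_le)
    also have "(\<Sum>k\<le>N. if k = 1 then d (f xs) else 0) = d (f xs)"
      using n by (simp add: sum.delta)
    finally show ?thesis using True by (simp add: delta_def)
  qed
qed

section \<open>The Maurer-Cartan equation and the twisted differential\<close>

context lie_algebra
begin

lemma br_minus_right: "br z (- x) = - br z x"
  using br_add_right[of z x "- x"] br_add_right[of z 0 0] by (simp add: add_eq_0_iff)

text \<open>The value on \<open>[x, y, z]\<close> is \<open>-2\<close> times the Jacobi sum.\<close>

lemma d_Lie_br: "d_Lie scale br 2 (cochain2 br) xs = 0"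
proof (cases "length xs = 3")
  case False
  then show ?thesis by (simp add: d_Lie_def dCE_def)
next
  case True
  then obtain x y z where xs: "xs = [x, y, z]"
    by (auto simp: numeral_3_eq_3 length_Suc_conv)
  have "nths xs (- {0}) = [y, z]" "nths xs (- {1}) = [x, z]" "nths xs (- {2}) = [x, y]"
    "nths xs (- {0, 1}) = [z]" "nths xs (- {0, 2}) = [y]" "nths xs (- {1, 2}) = [x]"
    by (simp_all add: xs nths_Cons)
  moreover have "{..<2 + 1 :: nat} = {0, 1, 2}" "{..<2 :: nat} = {0, 1}" "{..<1 :: nat} = {0}" "{..<0 :: nat} = {}"
    by auto
  ultimately have "d_Lie scale br 2 (cochain2 br) xs = - br x (br y z) + br y (br x z) - br z (br x y)
      + br (br x y) z - br (br x z) y + br (br y z) x"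
    using True unfolding d_Lie_def dCE_def by (simp add: xs cochain2_def)
  also have "\<dots> = - br x (br y z) - br y (br z x) - br z (br x y)
      - br z (br x y) - br y (br z x) - br x (br y z)"
    using br_swap[of z x] br_swap[of z "br x y"] br_swap[of y "br x z"] br_swap[of x "br y z"]
    by (simp add: br_minus_right)
  also have "\<dots> = - (br x (br y z) + br y (br z x) + br z (br x y)) - (br x (br y z) + br y (br z x) + br z (br x y))"
    by (simp add: algebra_simps)
  finally show ?thesis by (simp add: jacobi)
qed

end

context differential_lie_algebra
begin

lemma cochain1_Hom_alt: "cochain1 d \<in> Hom_alt scale 1"
proof -
  have "Vector_Spaces.linear scale scale (\<lambda>x. cochain1 d (xs[i := x]))" if "length xs = 1" "i < 1" for xs i
    using that linear_d by (simp add: cochain1_def)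
  then show ?thesis by (auto simp: Hom_alt_def cochain1_def)
qed

text \<open>One-element sets give the two Leibniz terms and the two-element set gives the term with
  \<open>lam\<close>, so this is the weighted Leibniz rule.\<close>

lemma delta_br: "delta scale lam d 2 (cochain2 br) xs = 0"
proof (cases "length xs = 2")
  case False
  then show ?thesis by (simp add: delta_def)
next
  case True
  then obtain x y where xs: "xs = [x, y]"
    by (auto simp: numeral_2_eq_2 length_Suc_conv)
  have two: "{..<2} = {0, 1 :: nat}" by auto
  have sub: "I = {} \<or> I = {0} \<or> I = {1} \<or> I = {0, 1}" if "I \<subseteq> {..<2}" for I :: "nat set"
    using that unfolding two Pow_iff[symmetric] by (simp only: Pow_insert Pow_empty) auto
  have I: "{I. I \<subseteq> {..<2} \<and> card I = 1} = {{0 :: nat}, {1}}"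
    "{I. I \<subseteq> {..<2} \<and> card I = 2} = {{0 :: nat, 1}}"
    by (auto dest!: sub)
  have "{1..2 :: nat} = {1, 2}" by auto
  then have "delta scale lam d 2 (cochain2 br) xs
      = br (d x) y + br x (d y) + scale lam (br (d x) (d y)) - d (br x y)"
    using I by (simp add: delta_def xs cochain2_def upt_rec numeral_2_eq_2)
  then show ?thesis by (simp add: d_br)
qed

end

theorem proposition5p1:
  fixes scale :: "'k::field_char_0 \<Rightarrow> 'g::ab_group_add \<Rightarrow> 'g"
    and br :: "'g \<Rightarrow> 'g \<Rightarrow> 'g" and lam :: 'k and d :: "'g \<Rightarrow> 'g"
  assumes "differential_lie_algebra scale br lam d"
  shows "maurer_cartan scale lam (cochain2 br, cochain1 d) \<and>
    (\<forall>n\<ge>1. sMA_deg scale (int n - 2) = {x \<in> C_DL scale n. n = 1 \<longrightarrow> snd x = 0}) \<and>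
    (\<exists>\<epsilon> :: nat \<Rightarrow> 'k. \<forall>n\<ge>1. \<epsilon> n \<in> {1, - 1} \<and>
      (\<forall>x\<in>C_DL scale n.
         l1_twisted scale lam (cochain2 br, cochain1 d) (int n - 2) x
           = smul scale (\<epsilon> n) (d_DL scale br lam d n x)))"
proof -
  interpret differential_lie_algebra scale br lam d by fact
  let ?\<mu> = "cochain2 br" and ?D = "cochain1 d"

  \<comment> \<open>The Maurer-Cartan equation\<close>
  have mc: "maurer_cartan scale lam (?\<mu>, ?D)"
  proof -
    let ?t = "\<lambda>k. smul scale (1 / fact (Suc k)) (l_op scale lam (replicate (Suc k) (0, ?\<mu>, ?D)))"
    let ?L = "\<lambda>k xs. l_mixed scale lam 2 ?\<mu> (replicate k (1, ?D)) xs"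
    have rep: "replicate (Suc k) x = replicate k x @ [x]" for k and x :: 'x
      by (simp add: replicate_append_same)
    have fst_t: "fst (?t k) xs = 0" for k xs
      unfolding rep by (simp add: smul_def fst_l_op_replicate nr_bracket_cochain2 d_Lie_br)
    have snd_t: "snd (?t k) xs = scale (1 / fact k) (?L k xs)" for k xs
    proof -
      \<comment> \<open>At \<open>k = 0\<close> the truncated \<open>k - 1\<close> is harmless
        because of the factor 0. In all there are \<open>k + 1\<close> equal terms, which turn
        \<open>1 / fact (Suc k)\<close> into \<open>1 / fact k\<close>.\<close>
      have "scale (of_nat k) (l_mixed scale lam 2 ?\<mu> (replicate (k - 1) (1, ?D) @ [(1, ?D)]) xs)
          = scale (of_nat k) (?L k xs)"
        by (cases k) (simp_all add: replicate_append_same)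
      then have "snd (l_op scale lam (replicate (Suc k) (0, ?\<mu>, ?D))) xs = scale (of_nat (Suc k)) (?L k xs)"
        unfolding rep by (simp add: snd_l_op_replicate scale_left_distrib)
      moreover have "(1 / fact (Suc k)) * of_nat (Suc k) = (1 / fact k :: 'k)"
        by (simp add: field_simps del: of_nat_Suc)
      ultimately show ?thesis
        by (simp only: smul_def snd_conv scale_scale)
    qed
    have "snd (?t k) xs = 0" if "2 < k" for k xs
      unfolding snd_t using that by (simp add: l_mixed_eq_0)
    then have sums: "fst (Sum_any ?t) xs = (\<Sum>k\<le>2. fst (?t k) xs)"
      "snd (Sum_any ?t) xs = (\<Sum>k\<le>2. snd (?t k) xs)" for xs
      using fst_t by (intro Sum_any_cochain_apply; blast)+
    \<comment> \<open>The component in \<open>A\<close> is \<open>delta\<close> of the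
      bracket.\<close>
    have "snd (Sum_any ?t) xs = 0" for xs
      unfolding sums snd_t
      by (simp only: sum_l_mixed_replicate_cochain1[OF vector_space_axioms cochain2_Hom_alt _ order_refl]
          one_le_numeral delta_br)
    moreover have "fst (Sum_any ?t) xs = 0" for xs
      unfolding sums fst_t by simp
    ultimately have "Sum_any ?t = 0"
      by (intro prod_eqI ext) simp_all
    moreover have "(?\<mu>, ?D) \<in> sMA_deg scale 0"
      using cochain2_Hom_alt cochain1_Hom_alt by (simp add: sMA_deg_def M_deg_def)
    ultimately show ?thesis by (simp add: maurer_cartan_def)
  qed

  \<comment> \<open>Comparison of the graded pieces\<close>
  have deg: "sMA_deg scale (int n - 2) = {x \<in> C_DL scale n. n = 1 \<longrightarrow> snd x = 0}" if "n \<ge> 1" for n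
  proof (cases "n = 1")
    case True
    \<comment> \<open>In degree -1 the summand from \<open>A\<close> is \<open>{0}\<close>, whereas
      \<open>C_DL\<close> has the arity 0 maps there; hence the condition \<open>snd x = 0\<close>
      for \<open>n = 1\<close>.\<close>
    have "(0 :: 'g cochain) \<in> Hom_alt scale 0" by (simp add: Hom_alt_def)
    then show ?thesis using True by (auto simp: sMA_deg_def M_deg_def C_DL_def)
  next
    case False
    then have "nat (int n - 1) = n - 1" using that by simp
    then show ?thesis using False that by (auto simp: sMA_deg_def M_deg_def C_DL_def)
  qed

  \<comment> \<open>The twisted differential\<close>
  have l1: "l1_twisted scale lam (?\<mu>, ?D) (int n - 2) x = smul scale (- 1) (d_DL scale br lam d n x)"
    if n: "n \<ge> 1" and xC: "x \<in> C_DL scale n" for n x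
  proof -
    obtain f g where x: "x = (f, g)" and f: "f \<in> Hom_alt scale n"
      using xC by (auto simp: C_DL_def split: if_splits)
    let ?t = "\<lambda>k. smul scale (1 / fact k) (l_op scale lam (replicate k (0, ?\<mu>, ?D) @ [(int n - 2, f, g)]))"
    let ?A = "\<lambda>k. l_mixed scale lam 2 ?\<mu> (replicate (k - 1) (1, ?D) @ [(n - 1, g)])"
    let ?L = "\<lambda>k. l_mixed scale lam n f (replicate k (1, ?D))"
    have nat: "nat (int n - 2 + 2) = n" "nat (int n - 2 + 1) = n - 1" using n by auto
    have fst_t: "fst (?t k) xs = (if k = 1 then - d_Lie scale br n f xs else 0)" for k xs
      unfolding smul_def fst_conv fst_l_op_replicate nat nr_bracket_cochain2 by simp
    have snd_t: "snd (?t k) xs = scale (of_nat k / fact k) (?A k xs) + scale (1 / fact k) (?L k xs)" for k xs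
      unfolding smul_def snd_conv snd_l_op_replicate nat by (simp add: scale_right_distrib)
    \<comment> \<open>\<open>?A k\<close> would fill \<open>k\<close> slots of the bracket, which
      has only two.\<close>
    have A: "?A k xs = 0" if "2 < k" for k xs
      using that by (intro l_mixed_eq_0) auto
    have "snd (?t k) xs = 0" if "n + 2 < k" for k xs
      unfolding snd_t using that by (simp add: A l_mixed_eq_0)
    then have sums: "fst (Sum_any ?t) xs = (\<Sum>k\<le>n + 2. fst (?t k) xs)"
      "snd (Sum_any ?t) xs = (\<Sum>k\<le>n + 2. snd (?t k) xs)" for xs
      using fst_t by (intro Sum_any_cochain_apply; simp)+
    have "fst (Sum_any ?t) xs = - d_Lie scale br n f xs" for xs
      unfolding sums fst_t by (subst sum.delta) auto
    moreover have "snd (Sum_any ?t) xs = d_DO scale br lam d (n - 1) g xs + delta scale lam d n f xs" for xs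
    proof -
      \<comment> \<open>The surviving indices are \<open>k = 1\<close>, the bracket with
        \<open>g\<close>, and \<open>k = 2\<close>, the operation \<open>l_3\<close>; the
        coefficient \<open>k / fact k\<close> is 1 for both.\<close>
      have A0: "scale (of_nat k / fact k) (?A k xs) = 0" if "k \<notin> {1, 2}" for k
      proof (cases "k = 0")
        case False
        then have "2 < k" using that by auto
        then show ?thesis by (simp only: A scale_zero_right)
      qed simp
      have "(\<Sum>k\<le>n + 2. scale (of_nat k / fact k) (?A k xs)) = (\<Sum>k\<in>{1, 2}. scale (of_nat k / fact k) (?A k xs))"
        by (rule sum.mono_neutral_right) (simp, simp, use A0 in blast)
      also have "\<dots> = nr_bracket scale 2 (n - 1) ?\<mu> g xs + l_higher scale lam 2 ?\<mu> [(1, ?D), (n - 1, g)] xs"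
        by (simp add: l_mixed_def fact_2)
      also have "\<dots> = d_DO scale br lam d (n - 1) g xs"
        by (simp only: nr_bracket_cochain2 d_DO_conv_l_higher)
      finally have "(\<Sum>k\<le>n + 2. scale (of_nat k / fact k) (?A k xs)) = \<dots>" .
      then show ?thesis
        unfolding sums snd_t sum.distrib
        by (simp only: sum_l_mixed_replicate_cochain1[OF vector_space_axioms f n le_add1])
    qed
    ultimately show ?thesis
      using n by (simp add: l1_twisted_def x smul_def d_DL_def prod_eq_iff fun_eq_iff)
  qed
  show ?thesis
    \<comment> \<open>The sign is \<open>- 1\<close> in every degree.\<close>
    using mc deg l1 by (intro conjI exI[of _ "\<lambda>_. - 1"]) auto
qed

end
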